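(* Let $T$ be a tree with at least $2$ vertices and let $b\geq 1$ be an integer. Then the following are equivalent: (i) Dominator has a winning strategy in the $b$-biased Maker-Breaker domination game on $T$ when Staller is the first player; (ii) $T$ is $b$-good.
   Context: The $b$-biased Maker-Breaker domination game on a finite graph $G$: Dominator and Staller alternately claim previously unclaimed vertices of $G$; in each of her turns Dominator claims up to $b$ vertices, in each of his turns Staller claims one vertex. Dominator wins if the set of vertices she claims contains a dominating set of $G$ (a set $D$ such that every vertex outside $D$ has a neighbour in $D$); otherwise Staller wins. For a forest $F$, $L(F)$ denotes its set of leaves (vertices of degree $1$ in $F$); $N(v)$ denotes the neighbourhood of $v$ in $T$. For a sequence $\mathbf v=(v_1,\dots,v_t)$ of distinct vertices of $T$, set $F_0:=T$ and $F_i:=F_{i-1}-(\{v_i\}\cup (N(v_i)\cap L(F_{i-1})))$ for $i=1,\dots,t$, and write $T_{\downarrow \mathbf v}:=F_t$ (for the empty sequence, $T_{\downarrow()}=T$). The sequence $\mathbf v$ is called admissible if $|N(v_i)\cap L(T_{\downarrow(v_1,\dots,v_{i-1})})|=b$ for every $i\in\{1,\dots,t\}$. A sequence $(v_1,\dots,v_t,u)$ is called problematic if $(v_1,\dots,v_t)$ is admissible and $|N(u)\cap L(T_{\downarrow(v_1,\dots,v_t)})|\geq b+1$. The tree $T$ is $b$-good if there is no problematic sequence for $T$. (Informally: one repeatedly deletes a vertex having exactly $b$ leaf neighbours together with those leaf neighbours, and $T$ is $b$-good if this can never produce a vertex with at least $b+1$ leaf neighbours.) *)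

theory Defs
  imports "Graph_Theory.Digraph_Component"
begin

text \<open>
  A finite simple graph is a \<open>pair_graph\<close>: a finite symmetric loop-free digraph whose arcs are
  ordered pairs, each undirected edge being present in both orientations.

  The library's \<open>tree\<close> and \<open>forest\<close> are not usable here: for a symmetric digraph, going along an
  edge and back is a \<open>cycle\<close> of length 2, so a symmetric digraph with an edge is never a
  \<open>forest\<close>. A cycle of the undirected graph is a \<open>cycle\<close> with at least 3 arcs.
\<close>

definition undirected_tree :: "'a pair_pre_digraph \<Rightarrow> bool" where
  "undirected_tree T \<longleftrightarrow>
     pair_graph T \<and> Digraph_Component.connected (with_proj T) \<and>
     \<not> (\<exists>p. pre_digraph.cycle (with_proj T) p \<and> 3 \<le> length p)"

definition nbrs :: "'a pair_pre_digraph \<Rightarrow> 'a \<Rightarrow> 'a set" where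
  "nbrs G v = {w. (v, w) \<in> parcs G}"

definition leaves :: "'a pair_pre_digraph \<Rightarrow> 'a set" where
  "leaves G = {v \<in> pverts G. card (nbrs G v) = 1}"

definition delete_verts :: "'a pair_pre_digraph \<Rightarrow> 'a set \<Rightarrow> 'a pair_pre_digraph" where
  "delete_verts G S =
     \<lparr> pverts = pverts G - S, parcs = {e \<in> parcs G. fst e \<notin> S \<and> snd e \<notin> S} \<rparr>"

definition dominating_set :: "'a pair_pre_digraph \<Rightarrow> 'a set \<Rightarrow> bool" where
  "dominating_set G D \<longleftrightarrow> D \<subseteq> pverts G \<and> (\<forall>v \<in> pverts G - D. nbrs G v \<inter> D \<noteq> {})"


section \<open>The biased Maker-Breaker domination game, Staller moving first\<close>

text \<open>
  A strategy of Dominator assigns to the list of all vertices claimed by Staller so far (in order,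
  the most recent one last) the set of vertices she claims in reply. Her own earlier moves are
  determined by the strategy and earlier moves of Staller, so this is dependence on the full
  history. \<open>play G f ss D\<close> holds if \<open>ss\<close> and \<open>D\<close> are the vertices claimed by Staller and by
  Dominator after finitely many full rounds in which Dominator follows \<open>f\<close>.
\<close>

inductive play :: "'a pair_pre_digraph \<Rightarrow> ('a list \<Rightarrow> 'a set) \<Rightarrow> 'a list \<Rightarrow> 'a set \<Rightarrow> bool"
  for G :: "'a pair_pre_digraph" and f :: "'a list \<Rightarrow> 'a set" where
  start: "play G f [] {}"
| round: "play G f (ss @ [v]) (D \<union> f (ss @ [v]))"
    if "play G f ss D" and "v \<in> pverts G - (set ss \<union> D)"

definition legal_strategy :: "'a pair_pre_digraph \<Rightarrow> nat \<Rightarrow> ('a list \<Rightarrow> 'a set) \<Rightarrow> bool" where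
  "legal_strategy G b f \<longleftrightarrow>
     (\<forall>ss D v. play G f ss D \<longrightarrow> v \<in> pverts G - (set ss \<union> D) \<longrightarrow>
        f (ss @ [v]) \<subseteq> pverts G - (insert v (set ss) \<union> D) \<and> card (f (ss @ [v])) \<le> b)"

text \<open>
  The game ends when every vertex is claimed. Staller claims a vertex in every round, so on a
  finite graph every play that follows a legal strategy ends.
\<close>

definition winning_strategy :: "'a pair_pre_digraph \<Rightarrow> nat \<Rightarrow> ('a list \<Rightarrow> 'a set) \<Rightarrow> bool" where
  "winning_strategy G b f \<longleftrightarrow>
     legal_strategy G b f \<and>
     (\<forall>ss D. play G f ss D \<longrightarrow> set ss \<union> D = pverts G \<longrightarrow>
        (\<exists>D' \<subseteq> D. dominating_set G D'))"

definition dominator_wins_staller_first :: "'a pair_pre_digraph \<Rightarrow> nat \<Rightarrow> bool" where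
  "dominator_wins_staller_first G b \<longleftrightarrow> (\<exists>f. winning_strategy G b f)"


section \<open>Good trees\<close>

definition prune :: "'a pair_pre_digraph \<Rightarrow> 'a list \<Rightarrow> 'a pair_pre_digraph" where
  "prune T vs = foldl (\<lambda>F v. delete_verts F ({v} \<union> (nbrs T v \<inter> leaves F))) T vs"

definition admissible :: "'a pair_pre_digraph \<Rightarrow> nat \<Rightarrow> 'a list \<Rightarrow> bool" where
  "admissible T b vs \<longleftrightarrow>
     distinct vs \<and> set vs \<subseteq> pverts T \<and>
     (\<forall>i < length vs. card (nbrs T (vs ! i) \<inter> leaves (prune T (take i vs))) = b)"

text \<open>
  All of \<open>vs @ [u]\<close> is required to be distinct. Without this, a vertex that has already been
  deleted could count as \<open>u\<close>, because \<open>nbrs\<close> refers to the original tree: for \<open>b = 1\<close>, take a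
  vertex with one leaf neighbour and two further neighbours, each of which has one leaf neighbour.
\<close>

definition problematic :: "'a pair_pre_digraph \<Rightarrow> nat \<Rightarrow> 'a list \<Rightarrow> bool" where
  "problematic T b us \<longleftrightarrow>
     (\<exists>vs u. us = vs @ [u] \<and> distinct us \<and> set us \<subseteq> pverts T \<and> admissible T b vs \<and>
        card (nbrs T u \<inter> leaves (prune T vs)) \<ge> b + 1)"

definition good :: "'a pair_pre_digraph \<Rightarrow> nat \<Rightarrow> bool" where
  "good T b \<longleftrightarrow> \<not> (\<exists>us. problematic T b us)"

end

theory Submission
  imports Defs "Graph_Theory.Vertex_Walk"
begin

text \<open>
  Both properties are equivalent to the existence of a spanning subgraph of \<open>T\<close> with all degrees
  between \<open>1\<close> and \<open>b\<close>. Given such a subgraph, Dominator answers every move of Staller with all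
  its neighbours in the subgraph, so that in the end each vertex of Staller has a neighbour of
  Dominator. If \<open>T\<close> is good, the subgraph consists of the stars removed by pruning as long as
  possible and of a subgraph of the remaining forest, where every vertex has fewer than \<open>b\<close> leaf
  neighbours: its leaf edges, and for each vertex without a leaf neighbour an edge to a child.
  If \<open>T\<close> is not good, Staller plays along a problematic sequence. Each move forces Dominator to
  take exactly the \<open>b\<close> current leaf neighbours, until the last one creates too many threats.
\<close>

section \<open>Leaves of induced subgraphs\<close>

text \<open>Pruning always leaves an induced subgraph of \<open>G\<close>, so it is recorded by its
  vertex set \<open>U\<close> alone, with neighbourhoods still taken in \<open>G\<close>.\<close>

definition leaves_in :: "'a pair_pre_digraph \<Rightarrow> 'a set \<Rightarrow> 'a set" where
  "leaves_in G U = {v \<in> U. card (nbrs G v \<inter> U) = 1}"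

lemma leaves_inD:
  assumes "l \<in> leaves_in G U" "v \<in> nbrs G l" "v \<in> U"
  shows "nbrs G l \<inter> U = {v}"
proof -
  obtain x where x: "nbrs G l \<inter> U = {x}"
    using assms(1) by (auto simp: leaves_in_def card_1_singleton_iff)
  moreover have "v \<in> {x}" unfolding x[symmetric] using assms by blast
  ultimately show ?thesis by simp
qed

lemma leaves_in_subset: "leaves_in G U \<subseteq> U"
  by (auto simp: leaves_in_def)

lemma prune_Nil [simp]: "prune T [] = T"
  by (simp add: prune_def)

lemma prune_snoc:
  "prune T (vs @ [v]) = delete_verts (prune T vs) ({v} \<union> (nbrs T v \<inter> leaves (prune T vs)))"
  by (simp add: prune_def)

definition no_isolated :: "'a pair_pre_digraph \<Rightarrow> 'a set \<Rightarrow> bool" where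
  "no_isolated G U \<longleftrightarrow> (\<forall>v\<in>U. nbrs G v \<inter> U \<noteq> {})"

text \<open>\<open>N v\<close> is the neighbourhood of \<open>v\<close> in a spanning subgraph of
  the graph induced on \<open>U\<close>; the last conjunct makes that subgraph undirected.\<close>

definition degree_cover :: "'a pair_pre_digraph \<Rightarrow> nat \<Rightarrow> 'a set \<Rightarrow> ('a \<Rightarrow> 'a set) \<Rightarrow> bool" where
  "degree_cover G b U N \<longleftrightarrow>
     (\<forall>v\<in>U. N v \<subseteq> nbrs G v \<inter> U \<and> N v \<noteq> {} \<and> card (N v) \<le> b \<and> (\<forall>w\<in>N v. v \<in> N w))"

lemma pcas_vwalk_arcs: "xs \<noteq> [] \<Longrightarrow> pcas (hd xs) (vwalk_arcs xs) (last xs)"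
  by (induction xs rule: vwalk_arcs.induct) auto

lemma pawalk_verts_vwalk_arcs: "xs \<noteq> [] \<Longrightarrow> pawalk_verts (hd xs) (vwalk_arcs xs) = xs"
  by (induction xs rule: vwalk_arcs.induct) auto

context pair_graph
begin

lemma finite_nbrs [simp]: "finite (nbrs G v)"
  by (rule finite_subset[OF _ pair_finite_verts]) (auto simp: nbrs_def dest: in_arcsD2)

lemma nbrs_subset: "nbrs G v \<subseteq> pverts G"
  by (auto simp: nbrs_def dest: in_arcsD2)

lemma nbrs_sym: "w \<in> nbrs G v \<longleftrightarrow> v \<in> nbrs G w"
  using pair_sym_arcs by (auto simp: nbrs_def symmetric_def sym_def)

lemma nbrs_symD: "w \<in> nbrs G v \<Longrightarrow> v \<in> nbrs G w"
  using nbrs_sym by blast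

lemma nbrs_irrefl: "w \<in> nbrs G v \<Longrightarrow> w \<noteq> v"
  using no_loops' by (auto simp: nbrs_def)

lemma pverts_prune_subset: "pverts (prune G vs) \<subseteq> pverts G - set vs"
  by (induction vs rule: rev_induct) (auto simp: prune_snoc delete_verts_def)

lemma parcs_prune:
  "parcs (prune G vs) = {e \<in> parcs G. fst e \<in> pverts (prune G vs) \<and> snd e \<in> pverts (prune G vs)}"
proof (induction vs rule: rev_induct)
  case Nil
  then show ?case by (auto dest: in_arcsD1 in_arcsD2)
next
  case (snoc v vs)
  then show ?case by (auto simp: prune_snoc delete_verts_def)
qed

lemma leaves_prune: "leaves (prune G vs) = leaves_in G (pverts (prune G vs))"
proof -
  have "nbrs (prune G vs) v = nbrs G v \<inter> pverts (prune G vs)" if "v \<in> pverts (prune G vs)" for v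
    using that parcs_prune[of vs] by (auto simp: nbrs_def)
  then show ?thesis by (auto simp: leaves_def leaves_in_def)
qed

lemma pverts_prune_snoc:
  "pverts (prune G (vs @ [v])) = pverts (prune G vs)
     - ({v} \<union> (nbrs G v \<inter> leaves_in G (pverts (prune G vs))))"
  by (simp add: prune_snoc delete_verts_def leaves_prune)


section \<open>Forests\<close>

text \<open>On a longest path inside \<open>U\<close>, every neighbour in \<open>U\<close> of the
  first vertex lies on the path, since otherwise the path could be extended at its front. A
  neighbour other than the second vertex closes the cycle.\<close>

lemma ex_long_cycle:
  assumes "finite U" "U \<noteq> {}" and deg: "\<And>v. v \<in> U \<Longrightarrow> card (nbrs G v \<inter> U) > 1"
    and UV: "U \<subseteq> pverts G"
  shows "\<exists>p. cycle p \<and> 3 \<le> length p"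
proof -
  define P where "P xs \<longleftrightarrow> xs \<noteq> [] \<and> distinct xs \<and> set xs \<subseteq> U \<and> set (vwalk_arcs xs) \<subseteq> parcs G" for xs
  obtain x where "x \<in> U" using \<open>U \<noteq> {}\<close> by blast
  then have "P [x]" by (simp add: P_def)
  moreover have "\<forall>xs. P xs \<longrightarrow> length xs < Suc (card U)"
    using \<open>finite U\<close> by (metis P_def card_mono distinct_card less_Suc_eq_le)
  ultimately have "\<exists>xs. P xs \<and> (\<forall>ys. P ys \<longrightarrow> length ys \<le> length xs)"
    by (rule ex_has_greatest_nat)
  then obtain xs where xs: "P xs" and max: "\<And>ys. P ys \<Longrightarrow> length ys \<le> length xs"
    by blast
  obtain v ys where xs_eq: "xs = v # ys" using xs by (cases xs) (auto simp: P_def)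
  have "v \<in> U" using xs by (simp add: P_def xs_eq)
  have in_ys: "w \<in> set ys" if "w \<in> nbrs G v \<inter> U" for w
  proof (rule ccontr)
    assume "w \<notin> set ys"
    moreover have "w \<noteq> v" "(w, v) \<in> parcs G"
      using that nbrs_irrefl[of w v] nbrs_sym[of w v] by (auto simp: nbrs_def)
    ultimately have "P (w # xs)"
      using that xs by (auto simp: P_def xs_eq)
    then show False using max by fastforce
  qed
  \<comment> \<open>Avoiding the successor of \<open>v\<close> rules out going along an edge and
    back. For empty \<open>ys\<close> the value of \<open>hd ys\<close> is unspecified but harmless:
    two neighbours leave a choice whatever it is.\<close>
  obtain w where w: "w \<in> nbrs G v \<inter> U" "w \<noteq> hd ys"
  proof -
    have "\<not> nbrs G v \<inter> U \<subseteq> {hd ys}"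
      using deg[OF \<open>v \<in> U\<close>] card_mono[of "{hd ys}" "nbrs G v \<inter> U"] by auto
    then show ?thesis using that by blast
  qed
  obtain as bs where ys: "ys = as @ w # bs" using in_ys[OF w(1)] by (meson split_list)
  have "as \<noteq> []" using w(2) ys by auto
  let ?C = "w # v # as @ [w]"
  have "set (vwalk_arcs (v # as @ [w])) \<subseteq> set (vwalk_arcs xs)"
    using set_vwalk_arcs_append1[of "v # as @ [w]" bs] by (simp add: xs_eq ys)
  also have "\<dots> \<subseteq> parcs G" using xs by (simp add: P_def)
  finally have arcs: "set (vwalk_arcs ?C) \<subseteq> parcs G"
    using w(1) nbrs_sym[of w v] by (auto simp: nbrs_def)
  have "cycle (vwalk_arcs ?C)"
    unfolding cycle_def awalk_def
  proof (intro exI conjI)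
    show "w \<in> pverts G" using w UV by auto
    show "set (vwalk_arcs ?C) \<subseteq> parcs G" by (fact arcs)
    show "pcas w (vwalk_arcs ?C) w" using pcas_vwalk_arcs[of ?C] by simp
    show "distinct (tl (pawalk_verts w (vwalk_arcs ?C)))"
      using pawalk_verts_vwalk_arcs[of ?C] xs by (simp add: P_def xs_eq ys)
    show "vwalk_arcs ?C \<noteq> []" by simp
  qed
  moreover have "3 \<le> length (vwalk_arcs ?C)"
    using \<open>as \<noteq> []\<close> pawalk_verts_vwalk_arcs[of ?C] length_awalk_verts[of w "vwalk_arcs ?C"]
    by (cases as) auto
  ultimately show ?thesis by blast
qed

text \<open>Successively remove a vertex with at most one remaining neighbour and make that
  neighbour its parent. Each edge is oriented when its first endpoint is removed.\<close>

lemma parent_function: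
  assumes "finite U"
    and "\<And>W. W \<subseteq> U \<Longrightarrow> W \<noteq> {} \<Longrightarrow> \<exists>v\<in>W. card (nbrs G v \<inter> W) \<le> 1"
  shows "\<exists>par. \<forall>v\<in>U. \<forall>w\<in>nbrs G v \<inter> U. par v = w \<or> par w = v"
  using assms
proof (induction U rule: finite_psubset_induct)
  case (psubset U)
  show ?case
  proof (cases "U = {}")
    case False
    then obtain v where v: "v \<in> U" "card (nbrs G v \<inter> U) \<le> 1" using psubset.prems[of U] by blast
    have "U - {v} \<subset> U" using v(1) by auto
    moreover have "\<exists>v\<in>W. card (nbrs G v \<inter> W) \<le> 1" if "W \<subseteq> U - {v}" "W \<noteq> {}" for W
      using psubset.prems that by blast
    ultimately have "\<exists>par. \<forall>x\<in>U - {v}. \<forall>y\<in>nbrs G x \<inter> (U - {v}). par x = y \<or> par y = x"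
      by (rule psubset.IH)
    then obtain par where
      par: "\<forall>x\<in>U - {v}. \<forall>y\<in>nbrs G x \<inter> (U - {v}). par x = y \<or> par y = x" ..
    have "\<forall>x\<in>nbrs G v \<inter> U. \<forall>y\<in>nbrs G v \<inter> U. x = y"
      using v(2) by (simp add: card_le_Suc0_iff_eq)
    \<comment> \<open>If \<open>v\<close> has no neighbour left, \<open>p\<close> is
      arbitrary.\<close>
    then obtain p where p: "nbrs G v \<inter> U \<subseteq> {p}"
      by (cases "nbrs G v \<inter> U = {}") blast+
    show ?thesis
    proof (rule exI[of _ "par(v := p)"], intro ballI)
      fix x y assume xy: "x \<in> U" "y \<in> nbrs G x \<inter> U"
      then have "x \<noteq> y" using nbrs_irrefl by blast
      with xy p par nbrs_sym[of x y]
      show "(par(v := p)) x = y \<or> (par(v := p)) y = x" by auto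
    qed
  qed simp
qed


section \<open>Spanning subgraphs with degrees between 1 and b\<close>

text \<open>Vertices without a leaf neighbour get an edge to a child. Distinct vertices have distinct
  children, so no degree grows by more than one.\<close>

lemma degree_cover_few_leaves:
  assumes fin: "finite U" and iso: "no_isolated G U"
    and degen: "\<And>W. W \<subseteq> U \<Longrightarrow> W \<noteq> {} \<Longrightarrow> \<exists>v\<in>W. card (nbrs G v \<inter> W) \<le> 1"
    and few: "\<And>v. v \<in> U \<Longrightarrow> card (nbrs G v \<inter> leaves_in G U) < b"
  shows "\<exists>N. degree_cover G b U N"
proof (cases "U = {}")
  case True
  then show ?thesis by (simp add: degree_cover_def)
next
  case False
  let ?L = "leaves_in G U"
  have card_pos: "card (nbrs G v \<inter> U) > 0" if "v \<in> U" for v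
    using iso that by (simp add: no_isolated_def card_gt_0_iff)
  \<comment> \<open>A leaf exists, and its neighbour has at least 1 but fewer than \<open>b\<close>
    leaf neighbours. So \<open>b\<close> is at least 2, which leaves room for one edge to a parent
    and one to a child.\<close>
  obtain l where l: "l \<in> ?L"
    using degen[OF order_refl False] card_pos by (force simp: leaves_in_def)
  then obtain x where x: "x \<in> nbrs G l" "x \<in> U"
    using iso by (auto simp: leaves_in_def no_isolated_def)
  then have "l \<in> nbrs G x \<inter> ?L" using l nbrs_symD by blast
  then have "card (nbrs G x \<inter> ?L) > 0" by (auto simp: card_gt_0_iff)
  then have b2: "b \<ge> 2" using few[OF x(2)] by linarith
  from parent_function[OF fin degen] obtain par
    where par: "\<forall>v\<in>U. \<forall>w\<in>nbrs G v \<inter> U. par v = w \<or> par w = v" ..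
  \<comment> \<open>The vertices that no leaf edge reaches. Each has at least two neighbours, of
    which at most one is its parent, so it has a child.\<close>
  define R where "R = {v \<in> U - ?L. nbrs G v \<inter> ?L = {}}"
  have "\<exists>w \<in> nbrs G v \<inter> U. par w = v" if "v \<in> R" for v
  proof -
    have "card (nbrs G v \<inter> U) > 1"
      using that card_pos[of v] by (auto simp: R_def leaves_in_def)
    then have "\<not> nbrs G v \<inter> U \<subseteq> {par v}"
      using card_mono[of "{par v}" "nbrs G v \<inter> U"] by auto
    then show ?thesis using par that by (auto simp: R_def)
  qed
  then obtain c where c: "\<And>v. v \<in> R \<Longrightarrow> c v \<in> nbrs G v \<inter> U \<and> par (c v) = v"
    by metis
  define E where "E v w \<longleftrightarrow> v \<in> ?L \<or> w \<in> ?L \<or> (v \<in> R \<and> w = c v) \<or> (w \<in> R \<and> v = c w)" for v w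
  define N where "N v = {w \<in> nbrs G v \<inter> U. E v w}" for v
  have pred: "{w \<in> R. v = c w} \<subseteq> {par v}" for v
    using c by auto
  have "degree_cover G b U N"
    unfolding degree_cover_def
  proof (intro ballI conjI)
    fix v assume v: "v \<in> U"
    show "N v \<subseteq> nbrs G v \<inter> U" by (auto simp: N_def)
    show "N v \<noteq> {}"
    proof (cases "v \<in> ?L")
      case True
      then show ?thesis using iso v by (auto simp: N_def E_def no_isolated_def)
    next
      case False
      then show ?thesis
        using c[of v] v leaves_in_subset[of G U] by (cases "v \<in> R") (auto simp: N_def E_def R_def)
    qed
    show "v \<in> N w" if "w \<in> N v" for w
      using that v nbrs_symD[of w v] by (auto simp: N_def E_def)
    consider "v \<in> ?L" | "v \<in> R" | "v \<notin> ?L" "v \<notin> R" by blast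
    then show "card (N v) \<le> b"
    proof cases
      case 1
      then have "card (N v) \<le> 1"
        using card_mono[of "nbrs G v \<inter> U" "N v"] by (auto simp: N_def leaves_in_def)
      then show ?thesis using b2 by linarith
    next
      \<comment> \<open>One edge goes to the chosen child, and at most one more to the
        parent.\<close>
      case 2
      then have "v \<notin> ?L" "nbrs G v \<inter> ?L = {}" by (auto simp: R_def)
      then have "N v \<subseteq> {c v} \<union> {w \<in> R. v = c w}" unfolding N_def E_def by blast
      then have "N v \<subseteq> {c v, par v}" using pred[of v] by blast
      then have "card (N v) \<le> card {c v, par v}" by (intro card_mono) auto
      also have "\<dots> \<le> 2" by (simp add: card_insert_le_m1)
      finally show ?thesis using b2 by linarith
    next
      \<comment> \<open>There are fewer than \<open>b\<close> leaf edges, and \<open>v\<close> can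
        be the chosen child of its parent only.\<close>
      case 3
      then have "N v \<subseteq> {w \<in> R. v = c w} \<union> (nbrs G v \<inter> ?L)" unfolding N_def E_def by blast
      then have "N v \<subseteq> insert (par v) (nbrs G v \<inter> ?L)" using pred[of v] by blast
      then have "card (N v) \<le> card (insert (par v) (nbrs G v \<inter> ?L))" by (intro card_mono) auto
      also have "\<dots> \<le> Suc (card (nbrs G v \<inter> ?L))" by (rule card_insert_le_m1) auto
      finally show ?thesis using few[OF v] by linarith
    qed
  qed
  then show ?thesis by blast
qed

text \<open>A vertex isolated by the deletion has no deleted leaf as a neighbour, since such a leaf
  is adjacent to \<open>v\<close> only. Hence its sole neighbour was \<open>v\<close>, and it would
  itself have been deleted as a leaf.\<close>

lemma no_isolated_prune:
  assumes "no_isolated G U" "v \<in> U"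
  shows "no_isolated G (U - ({v} \<union> (nbrs G v \<inter> leaves_in G U)))"
  unfolding no_isolated_def
proof (intro ballI notI)
  let ?S = "{v} \<union> (nbrs G v \<inter> leaves_in G U)"
  fix w assume w: "w \<in> U - ?S" and empty: "nbrs G w \<inter> (U - ?S) = {}"
  have "x = v" if x: "x \<in> nbrs G w \<inter> U" for x
  proof (rule ccontr)
    assume "x \<noteq> v"
    then have "x \<in> nbrs G v" "x \<in> leaves_in G U" using x empty by auto
    then have "nbrs G x \<inter> U = {v}" using leaves_inD nbrs_symD \<open>v \<in> U\<close> by metis
    then show False using w x nbrs_symD[of x w] by auto
  qed
  then have "nbrs G w \<inter> U = {v}" using assms(1) w by (auto simp: no_isolated_def)
  then have "w \<in> nbrs G v \<inter> leaves_in G U"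
    using w nbrs_sym[of v w] by (auto simp: leaves_in_def)
  then show False using w by blast
qed

text \<open>The star formed by \<open>v\<close> and its \<open>b\<close> leaves is disjoint from the
  cover of the rest; its centre gets degree \<open>b\<close> and its leaves degree 1.\<close>

lemma degree_cover_extend_star:
  assumes N: "degree_cover G b (U - ({v} \<union> (nbrs G v \<inter> leaves_in G U))) N"
    and v: "v \<in> U" and card: "card (nbrs G v \<inter> leaves_in G U) = b" and "b \<ge> 1"
  shows "\<exists>N. degree_cover G b U N"
proof -
  let ?S = "nbrs G v \<inter> leaves_in G U"
  define M where "M x = (if x = v then ?S else if x \<in> ?S then {v} else N x)" for x
  have "v \<notin> ?S" using nbrs_irrefl by blast
  have "?S \<noteq> {}" using card \<open>b \<ge> 1\<close> by auto
  have "degree_cover G b U M"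
    unfolding degree_cover_def
  proof
    fix x assume "x \<in> U"
    then consider "x = v" | "x \<in> ?S" "x \<noteq> v" | "x \<in> U - ({v} \<union> ?S)" by blast
    then show "M x \<subseteq> nbrs G x \<inter> U \<and> M x \<noteq> {} \<and> card (M x) \<le> b \<and> (\<forall>w\<in>M x. x \<in> M w)"
    proof cases
      case 1
      then show ?thesis using \<open>v \<notin> ?S\<close> \<open>?S \<noteq> {}\<close> card leaves_in_subset[of G U]
        by (auto simp: M_def)
    next
      case 2
      then show ?thesis using v \<open>b \<ge> 1\<close> nbrs_symD[of x v] by (auto simp: M_def)
    next
      case 3
      then have "N x \<subseteq> nbrs G x \<inter> (U - ({v} \<union> ?S)) \<and> N x \<noteq> {} \<and> card (N x) \<le> b \<and> (\<forall>w\<in>N x. x \<in> N w)"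
        using N unfolding degree_cover_def by blast
      then show ?thesis using 3 by (auto simp: M_def)
    qed
  qed
  then show ?thesis by blast
qed

lemma admissible_snoc:
  assumes "admissible G b vs" "v \<in> pverts (prune G vs)"
    and "card (nbrs G v \<inter> leaves (prune G vs)) = b"
  shows "admissible G b (vs @ [v])"
  using assms pverts_prune_subset[of vs]
  by (auto simp: admissible_def nth_append less_Suc_eq)

text \<open>Induction on the number of vertices left. A vertex with exactly \<open>b\<close> leaf
  neighbours is pruned and its star added back. If there is none, goodness excludes more than
  \<open>b\<close> as well, so \<open>degree_cover_few_leaves\<close> applies.\<close>

lemma good_degree_cover:
  assumes "good G b" "b \<ge> 1"
    and degen: "\<And>W. W \<subseteq> pverts G \<Longrightarrow> W \<noteq> {} \<Longrightarrow> \<exists>v\<in>W. card (nbrs G v \<inter> W) \<le> 1"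
    and "admissible G b vs" "no_isolated G (pverts (prune G vs))"
  shows "\<exists>N. degree_cover G b (pverts (prune G vs)) N"
  using assms(4,5)
proof (induction "card (pverts (prune G vs))" arbitrary: vs rule: less_induct)
  case less
  let ?U = "pverts (prune G vs)"
  have UV: "?U \<subseteq> pverts G - set vs" by (rule pverts_prune_subset)
  then have fin: "finite ?U" using pair_finite_verts finite_subset by blast
  show ?case
  proof (cases "\<exists>v\<in>?U. card (nbrs G v \<inter> leaves_in G ?U) = b")
    case True
    then obtain v where v: "v \<in> ?U" "card (nbrs G v \<inter> leaves_in G ?U) = b" by blast
    have "?U - ({v} \<union> (nbrs G v \<inter> leaves_in G ?U)) \<subset> ?U" using v(1) by blast
    then have "card (pverts (prune G (vs @ [v]))) < card ?U"
      unfolding pverts_prune_snoc by (rule psubset_card_mono[OF fin])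
    moreover have "admissible G b (vs @ [v])"
      using admissible_snoc less.prems(1) v by (simp add: leaves_prune)
    ultimately have "\<exists>N. degree_cover G b (pverts (prune G (vs @ [v]))) N"
      using less.hyps no_isolated_prune[OF less.prems(2) v(1)]
      unfolding pverts_prune_snoc[symmetric] by blast
    then show ?thesis
      using degree_cover_extend_star v \<open>b \<ge> 1\<close> unfolding pverts_prune_snoc by blast
  next
    case False
    have "card (nbrs G v \<inter> leaves_in G ?U) < b" if v: "v \<in> ?U" for v
    proof -
      have "\<not> problematic G b (vs @ [v])" using assms(1) by (simp add: good_def)
      then have "\<not> card (nbrs G v \<inter> leaves_in G ?U) \<ge> b + 1"
        using less.prems(1) v UV by (auto simp: problematic_def leaves_prune admissible_def)
      then show ?thesis using False v by force
    qed
    moreover have "\<exists>v\<in>W. card (nbrs G v \<inter> W) \<le> 1" if "W \<subseteq> ?U" "W \<noteq> {}" for W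
      using that UV degen[of W] by blast
    ultimately show ?thesis
      using degree_cover_few_leaves[OF fin less.prems(2)] by blast
  qed
qed


section \<open>Dominator's strategy\<close>

text \<open>The replies are legal because \<open>N\<close> is symmetric: if Staller already had a vertex of \<open>N v\<close>,
  Dominator would have taken \<open>v\<close> in reply.\<close>

lemma degree_cover_imp_dominator_wins:
  assumes N: "degree_cover G b (pverts G) N"
  shows "dominator_wins_staller_first G b"
proof -
  \<comment> \<open>The vertices subtracted are exactly those Dominator already owns, as the fact
    \<open>play\<close> below shows.\<close>
  define f where "f ss = N (last ss) - (\<Union>s\<in>set (butlast ss). N s)" for ss
  have cov: "N v \<subseteq> nbrs G v" "N v \<noteq> {}" "card (N v) \<le> b" "w \<in> N v \<Longrightarrow> v \<in> N w"
    if "v \<in> pverts G" for v w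
    using N that unfolding degree_cover_def by auto
  have f_snoc: "f (ss @ [v]) = N v - (\<Union>s\<in>set ss. N s)" for ss v
    by (simp add: f_def)
  have play: "D = (\<Union>s\<in>set ss. N s) \<and> set ss \<subseteq> pverts G" if "play G f ss D" for ss D
    using that by induction (auto simp: f_snoc)
  have "legal_strategy G b f"
    unfolding legal_strategy_def
  proof (intro allI impI conjI)
    fix ss D v assume p: "play G f ss D" and v: "v \<in> pverts G - (set ss \<union> D)"
    note pl = play[OF p]
    show "f (ss @ [v]) \<subseteq> pverts G - (insert v (set ss) \<union> D)"
    proof
      fix w assume "w \<in> f (ss @ [v])"
      then have w: "w \<in> N v" "w \<notin> D" using pl by (auto simp: f_snoc)
      then have "w \<in> nbrs G v" "v \<in> N w" using cov v by auto
      then have "w \<in> pverts G" "w \<noteq> v" using nbrs_subset nbrs_irrefl by blast+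
      moreover have "w \<notin> set ss" using pl v \<open>v \<in> N w\<close> by auto
      ultimately show "w \<in> pverts G - (insert v (set ss) \<union> D)" using w by simp
    qed
    have "card (f (ss @ [v])) \<le> card (N v)"
      using v cov(1)[of v] finite_subset[OF _ finite_nbrs] by (intro card_mono) (auto simp: f_snoc)
    then show "card (f (ss @ [v])) \<le> b" using cov(3)[of v] v by simp
  qed
  moreover have "dominating_set G D" if p: "play G f ss D" and full: "set ss \<union> D = pverts G" for ss D
    unfolding dominating_set_def
  proof (intro conjI ballI)
    show "D \<subseteq> pverts G" using full by blast
    fix v assume v: "v \<in> pverts G - D"
    then have "N v \<subseteq> D" using play[OF p] full by auto
    then show "nbrs G v \<inter> D \<noteq> {}" using cov(1,2)[of v] v by blast
  qed
  ultimately have "winning_strategy G b f" unfolding winning_strategy_def by blast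
  then show ?thesis unfolding dominator_wins_staller_first_def by blast
qed


section \<open>Staller's strategy\<close>

lemma play_disjoint:
  assumes "legal_strategy G b f" "play G f ss D"
  shows "set ss \<subseteq> pverts G \<and> D \<subseteq> pverts G \<and> set ss \<inter> D = {}"
  using assms(2)
proof induction
  case (round ss D v)
  then have "f (ss @ [v]) \<subseteq> pverts G - (insert v (set ss) \<union> D)"
    using assms(1) unfolding legal_strategy_def by blast
  with round show ?case by auto
qed simp

text \<open>\<open>winning_strategy\<close> judges only plays in which every vertex is claimed, so a
  position reached on the way has to be carried to the end; Staller may claim anything that is
  left.\<close>

lemma play_extend_full:
  assumes legal: "legal_strategy G b f" and "play G f ss D"
  shows "\<exists>ss' D'. play G f ss' D' \<and> set ss \<subseteq> set ss' \<and> set ss' \<union> D' = pverts G"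
  using assms(2)
proof (induction "card (pverts G - (set ss \<union> D))" arbitrary: ss D rule: less_induct)
  case less
  show ?case
  proof (cases "pverts G \<subseteq> set ss \<union> D")
    case True
    then show ?thesis using play_disjoint[OF legal less.prems] less.prems by blast
  next
    case False
    then obtain v where v: "v \<in> pverts G - (set ss \<union> D)" by blast
    have p: "play G f (ss @ [v]) (D \<union> f (ss @ [v]))" using play.round[OF less.prems v] .
    have "card (pverts G - (set (ss @ [v]) \<union> (D \<union> f (ss @ [v])))) < card (pverts G - (set ss \<union> D))"
      using v pair_finite_verts by (intro psubset_card_mono) auto
    from less.hyps[OF this p] show ?thesis by auto
  qed
qed

text \<open>Dominator's final set is disjoint from Staller's, so it neither contains nor dominates
  \<open>w\<close>.\<close>

lemma staller_no_closed_nbhd: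
  assumes win: "winning_strategy G b f" and p: "play G f ss D"
    and w: "w \<in> set ss" "nbrs G w \<subseteq> set ss"
  shows False
proof -
  have legal: "legal_strategy G b f" using win by (simp add: winning_strategy_def)
  obtain ss' D' where p': "play G f ss' D'" "set ss \<subseteq> set ss'" "set ss' \<union> D' = pverts G"
    using play_extend_full[OF legal p] by blast
  then obtain D where "D \<subseteq> D'" "dominating_set G D" using win unfolding winning_strategy_def by blast
  then show False using play_disjoint[OF legal p'(1)] p' w unfolding dominating_set_def by blast
qed

text \<open>Otherwise Staller claims \<open>l\<close> next and owns its closed
  neighbourhood.\<close>

lemma dominator_must_reply:
  assumes win: "winning_strategy G b f" and p: "play G f ss D"
    and l: "l \<in> pverts G" "l \<notin> set ss" "nbrs G l \<subseteq> set ss"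
  shows "l \<in> D"
proof (rule ccontr)
  assume "l \<notin> D"
  then have "play G f (ss @ [l]) (D \<union> f (ss @ [l]))" using p l by (intro play.round) auto
  then show False using staller_no_closed_nbhd[OF win, of _ _ l] l by fastforce
qed

text \<open>While Staller plays along an admissible sequence, the unclaimed vertices are those of the
  pruned graph, and their neighbours outside of it all belong to Staller.\<close>

definition forcing_position :: "'a list \<Rightarrow> 'a set \<Rightarrow> bool" where
  "forcing_position vs D \<longleftrightarrow>
     D \<inter> pverts (prune G vs) = {} \<and>
     pverts G = set vs \<union> D \<union> pverts (prune G vs) \<and>
     (\<forall>w\<in>pverts (prune G vs). nbrs G w - pverts (prune G vs) \<subseteq> set vs) \<and>
     (\<forall>d\<in>D. nbrs G d \<inter> pverts (prune G vs) = {})"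

text \<open>When Staller claims \<open>v\<close>, each leaf of the pruned graph at \<open>v\<close>
  loses its last neighbour outside Staller's set, so Dominator must take it at once. That
  \<open>v\<close> is still unclaimed holds because Dominator's vertices have no neighbours in the
  pruned graph.\<close>

lemma forced_leaves:
  assumes win: "winning_strategy G b f" and p: "play G f vs D" and F: "forcing_position vs D"
    and v: "v \<in> pverts G - set vs" and ne: "nbrs G v \<inter> leaves_in G (pverts (prune G vs)) \<noteq> {}"
  shows "v \<in> pverts (prune G vs)" "v \<notin> D"
    "nbrs G v \<inter> leaves_in G (pverts (prune G vs)) \<subseteq> f (vs @ [v])"
    "card (f (vs @ [v])) \<le> b" "finite (f (vs @ [v]))"
proof -
  let ?U = "pverts (prune G vs)"
  show "v \<notin> D" using F ne leaves_in_subset[of G ?U] unfolding forcing_position_def by blast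
  then show vU: "v \<in> ?U" using F v unfolding forcing_position_def by blast
  have v': "v \<in> pverts G - (set vs \<union> D)" using v \<open>v \<notin> D\<close> by blast
  have legal: "legal_strategy G b f" using win by (simp add: winning_strategy_def)
  then have "f (vs @ [v]) \<subseteq> pverts G" and card: "card (f (vs @ [v])) \<le> b"
    using p v' unfolding legal_strategy_def by blast+
  show "card (f (vs @ [v])) \<le> b" by (fact card)
  show "finite (f (vs @ [v]))"
    using \<open>f (vs @ [v]) \<subseteq> pverts G\<close> pair_finite_verts by (rule finite_subset)
  show "nbrs G v \<inter> leaves_in G ?U \<subseteq> f (vs @ [v])"
  proof
    fix l assume l: "l \<in> nbrs G v \<inter> leaves_in G ?U"
    then have lU: "l \<in> ?U" using leaves_in_subset[of G ?U] by blast
    have "nbrs G l \<inter> ?U = {v}" using l leaves_inD nbrs_symD vU by (metis IntD1 IntD2)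
    then have "nbrs G l \<subseteq> {v} \<union> (nbrs G l - ?U)" by blast
    moreover have "nbrs G l - ?U \<subseteq> set vs" using F lU unfolding forcing_position_def by blast
    ultimately have "nbrs G l \<subseteq> set (vs @ [v])" by auto
    moreover have "l \<in> pverts G" "l \<notin> set (vs @ [v])"
      using lU pverts_prune_subset[of vs] l nbrs_irrefl[of l v] by auto
    ultimately have "l \<in> D \<union> f (vs @ [v])"
      using dominator_must_reply[OF win play.round[OF p v']] by blast
    then show "l \<in> f (vs @ [v])" using F lU unfolding forcing_position_def by blast
  qed
qed

lemma admissible_butlast: "admissible G b (vs @ [v]) \<Longrightarrow> admissible G b vs"
  unfolding admissible_def by (auto simp: nth_append less_Suc_eq split: if_splits)

text \<open>The \<open>b\<close> forced leaves exhaust Dominator's reply, so her play along the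
  sequence is determined and coincides with pruning.\<close>

lemma admissible_forcing:
  assumes win: "winning_strategy G b f" and "admissible G b vs" "b \<ge> 1"
  shows "\<exists>D. play G f vs D \<and> forcing_position vs D"
  using assms(2)
proof (induction vs rule: rev_induct)
  case Nil
  then show ?case
    by (intro exI[of _ "{}"]) (auto simp: forcing_position_def play.start nbrs_def dest: in_arcsD2)
next
  case (snoc v vs)
  let ?U = "pverts (prune G vs)"
  let ?L = "nbrs G v \<inter> leaves_in G ?U"
  obtain D where p: "play G f vs D" and F: "forcing_position vs D"
    using snoc admissible_butlast by blast
  have v: "v \<in> pverts G - set vs" using snoc.prems by (auto simp: admissible_def)
  have "card ?L = b"
    using snoc.prems by (auto simp: admissible_def leaves_prune nth_append)
  then have "?L \<noteq> {}" using \<open>b \<ge> 1\<close> by auto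
  note fl = forced_leaves[OF win p F v this]
  have fL: "f (vs @ [v]) = ?L"
    using fl \<open>card ?L = b\<close> card_seteq[of "f (vs @ [v])" ?L] by simp
  have L_nbrs: "nbrs G l \<inter> ?U = {v}" if "l \<in> ?L" for l
    using that leaves_inD nbrs_symD fl(1) by (metis IntD1 IntD2)
  have "forcing_position (vs @ [v]) (D \<union> ?L)"
    unfolding forcing_position_def pverts_prune_snoc
  proof (intro conjI ballI)
    show "(D \<union> ?L) \<inter> (?U - ({v} \<union> ?L)) = {}"
      using F unfolding forcing_position_def by blast
    show "pverts G = set (vs @ [v]) \<union> (D \<union> ?L) \<union> (?U - ({v} \<union> ?L))"
      using F fl(1) leaves_in_subset[of G ?U] unfolding forcing_position_def by auto
    show "nbrs G d \<inter> (?U - ({v} \<union> ?L)) = {}" if "d \<in> D \<union> ?L" for d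
      using that F L_nbrs unfolding forcing_position_def by blast
    \<comment> \<open>The leaves deleted with \<open>v\<close> are not adjacent to \<open>w\<close>,
      so the only neighbour that \<open>w\<close> can newly lose is \<open>v\<close>, which is
      Staller's.\<close>
    show "nbrs G w - (?U - ({v} \<union> ?L)) \<subseteq> set (vs @ [v])" if w: "w \<in> ?U - ({v} \<union> ?L)" for w
    proof -
      have "nbrs G w \<inter> ?L = {}"
      proof (rule ccontr)
        assume "nbrs G w \<inter> ?L \<noteq> {}"
        then obtain l where "l \<in> nbrs G w" "l \<in> ?L" by blast
        then have "w \<in> nbrs G l \<inter> ?U" using w nbrs_symD by blast
        then show False using L_nbrs[OF \<open>l \<in> ?L\<close>] w by blast
      qed
      then show ?thesis using F w unfolding forcing_position_def by auto
    qed
  qed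
  moreover have "play G f (vs @ [v]) (D \<union> ?L)"
    using play.round[OF p, of v] v fl(2) fL by auto
  ultimately show ?case by blast
qed

lemma dominator_wins_imp_good:
  assumes "dominator_wins_staller_first G b" "b \<ge> 1"
  shows "good G b"
  unfolding good_def
proof
  obtain f where win: "winning_strategy G b f"
    using assms by (auto simp: dominator_wins_staller_first_def)
  assume "\<exists>us. problematic G b us"
  then obtain vs u where u: "u \<in> pverts G - set vs" and adm: "admissible G b vs"
    and card: "b + 1 \<le> card (nbrs G u \<inter> leaves_in G (pverts (prune G vs)))"
    by (auto simp: problematic_def leaves_prune)
  obtain D where D: "play G f vs D" "forcing_position vs D"
    using admissible_forcing[OF win adm \<open>b \<ge> 1\<close>] by blast
  have "nbrs G u \<inter> leaves_in G (pverts (prune G vs)) \<noteq> {}"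
    using card by force
  note fl = forced_leaves[OF win D u this]
  \<comment> \<open>The last move threatens at least \<open>b + 1\<close> leaves, but the reply has
    at most \<open>b\<close> vertices.\<close>
  show False using card_mono[OF fl(5,3)] fl(4) card by linarith
qed

section \<open>Connectedness and the equivalence for trees\<close>

lemma connected_no_isolated:
  assumes "connected (with_proj G)" "card (pverts G) \<ge> 2"
  shows "no_isolated G (pverts G)"
  unfolding no_isolated_def
proof
  fix v assume v: "v \<in> pverts G"
  have "\<not> pverts G \<subseteq> {v}"
    using assms(2) card_mono[of "{v}" "pverts G"] by auto
  then obtain w where w: "w \<in> pverts G" "w \<noteq> v" by blast
  have "strongly_connected (with_proj G)"
    using symmetric_connected_imp_strongly_connected pair_sym_arcs assms(1) by blast
  then have "v \<rightarrow>\<^sup>*\<^bsub>with_proj G\<^esub> w" using v w by (auto simp: strongly_connected_def)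
  then obtain x where "(v, x) \<in> parcs G"
    using w by (cases rule: converse_reachable_cases) auto
  then show "nbrs G v \<inter> pverts G \<noteq> {}" using in_arcsD2 by (auto simp: nbrs_def)
qed

end

theorem theorem1p5:
  fixes T :: "'a pair_pre_digraph" and b :: nat
  assumes "undirected_tree T" and "card (pverts T) \<ge> 2" and "b \<ge> 1"
  shows "dominator_wins_staller_first T b \<longleftrightarrow> good T b"
proof -
  interpret pair_graph T using assms(1) by (simp add: undirected_tree_def)
  show ?thesis
  proof
    assume "good T b"
    \<comment> \<open>Acyclicity in a hereditary form, which passes to every pruned graph.\<close>
    have "\<exists>v\<in>W. card (nbrs T v \<inter> W) \<le> 1" if W: "W \<subseteq> pverts T" "W \<noteq> {}" for W
    proof (rule ccontr)
      assume "\<not> ?thesis"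
      then have "\<exists>p. cycle p \<and> 3 \<le> length p"
        using W finite_subset[OF W(1) pair_finite_verts] by (intro ex_long_cycle[of W]) force+
      then show False using assms(1) by (auto simp: undirected_tree_def)
    qed
    moreover have "admissible T b []" by (simp add: admissible_def)
    moreover have "no_isolated T (pverts T)"
      using connected_no_isolated assms(1,2) by (simp add: undirected_tree_def)
    ultimately have "\<exists>N. degree_cover T b (pverts T) N"
      using good_degree_cover[OF \<open>good T b\<close> \<open>b \<ge> 1\<close>, of "[]"] by simp
    then show "dominator_wins_staller_first T b"
      using degree_cover_imp_dominator_wins by blast
  qed (rule dominator_wins_imp_good[OF _ \<open>b \<ge> 1\<close>])
qed

end
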